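(* Let $N\ge1$ be an integer, $\mathcal{N}=\{1,\dots,N\}$, and let $\lambda_1\ge\dots\ge\lambda_N>0$, $\sigma_\epsilon^2\ge0$, $0<P_{max}<\infty$, $C_I>0$, $C_{EH}>0$ be real numbers. Consider problem (A), in the variables $(P_i,\pi_i)_{i\in\mathcal{N}}$: $$\min\ P=\sum_{i\in\mathcal{N}}P_i\quad\text{s.t.}\quad \sum_{i\in\mathcal{N}}\log\left(1+\frac{\pi_iP_i\lambda_i}{1+\sigma_\epsilon^2P}\right)\ge C_I,\quad \sum_{i\in\mathcal{N}}(1-\pi_i)(P_i\lambda_i+\sigma_\epsilon^2P)\ge C_{EH},$$ $$0\le P_i\le P_{max},\quad \pi_i\in\{0,1\},\quad i\in\mathcal{N}.$$ Let $M=\lceil\log N\rceil$ and $N_u=2^M$, and consider the mixed-integer second-order cone program (B), in the variables $P_i,\pi_i,P_i^{\pi},P_i^{tot}$ ($i\in\mathcal{N}$), $x_{k,i}$ ($k=0,\dots,M$, $i=1,\dots,2^{M-k}$) and $t$, of minimizing $P=\sum_{i\in\mathcal{N}}P_i$ subject to: 1. $x_{k-1,2i-1}\,x_{k-1,2i}\ge x_{k,i}^2$ for $k=1,\dots,M$, $i=1,\dots,2^{M-k}$; 2. $x_{M,1}\ge t$ and $t=2^{C_I/N_u}(1+\sigma_\epsilon^2P)$; 3. $x_{0,i}=1+\sigma_\epsilon^2P+P_i^{\pi}\lambda_i$ for $i\in\mathcal{N}$, and $x_{0,i}=1+\sigma_\epsilon^2P$ for $i=N+1,\dots,N_u$; 4.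 $x_{k,i}\ge0$ for $k=0,\dots,M$, $i=1,\dots,2^{M-k}$; 5. $\sum_{i\in\mathcal{N}}(P_i-P_i^{\pi})\lambda_i+\sigma_\epsilon^2\left(NP-\sum_{i\in\mathcal{N}}P_i^{tot}\right)\ge C_{EH}$; 6. $P_i^{\pi}\le\pi_iP_{max}$, $P_i^{\pi}\le P_i$, $P_i^{\pi}\ge P_i-(1-\pi_i)P_{max}$, $P_i^{\pi}\ge0$ for $i\in\mathcal{N}$; 7. $P_i^{tot}\le\pi_iNP_{max}$, $P_i^{tot}\le P$, $P_i^{tot}\ge P-(1-\pi_i)NP_{max}$, $P_i^{tot}\ge0$ for $i\in\mathcal{N}$; 8. $0\le P_i\le P_{max}$, $\pi_i\in\{0,1\}$ for $i\in\mathcal{N}$. Then (A) and (B) are equivalent: $(P_i,\pi_i)_{i\in\mathcal{N}}$ is feasible for (A) if and only if there exist values of the remaining variables $P_i^{\pi},P_i^{tot},x_{k,i},t$ that together with it form a feasible point of (B) (with the same objective value $P$).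
   Context: $\log$ denotes the logarithm to base 2. *)

theory Defs
  imports Complex_Main
begin

text \<open>
  Vectors indexed by \<open>{1..N}\<close> are functions on \<^typ>\<open>nat\<close>, of which only the values at the indices
  in \<open>{1..N}\<close> are ever constrained; likewise \<open>x k i\<close> matters only for \<open>k \<le> M\<close> and
  \<open>1 \<le> i \<le> 2 ^ (M - k)\<close>. The parameter \<open>s2\<close> stands for \<open>\<sigma>\<^sub>\<epsilon>\<^sup>2\<close>.
\<close>

definition total_power :: "nat \<Rightarrow> (nat \<Rightarrow> real) \<Rightarrow> real" where
  "total_power N p = (\<Sum>i\<in>{1..N}. p i)"

definition feasible_A ::
  "nat \<Rightarrow> (nat \<Rightarrow> real) \<Rightarrow> real \<Rightarrow> real \<Rightarrow> real \<Rightarrow> real \<Rightarrow>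
   (nat \<Rightarrow> real) \<Rightarrow> (nat \<Rightarrow> real) \<Rightarrow> bool" where
  "feasible_A N lam s2 Pmax CI CEH p \<pi> \<longleftrightarrow>
     (let P = total_power N p in
       (\<Sum>i\<in>{1..N}. log 2 (1 + \<pi> i * p i * lam i / (1 + s2 * P))) \<ge> CI \<and>
       (\<Sum>i\<in>{1..N}. (1 - \<pi> i) * (p i * lam i + s2 * P)) \<ge> CEH \<and>
       (\<forall>i\<in>{1..N}. 0 \<le> p i \<and> p i \<le> Pmax) \<and>
       (\<forall>i\<in>{1..N}. \<pi> i \<in> {0, 1}))"

definition objective_A :: "nat \<Rightarrow> (nat \<Rightarrow> real) \<Rightarrow> (nat \<Rightarrow> real) \<Rightarrow> real" where
  "objective_A N p \<pi> = total_power N p"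

definition levels :: "nat \<Rightarrow> nat" where
  "levels N = nat \<lceil>log 2 (real N)\<rceil>"

definition feasible_B ::
  "nat \<Rightarrow> (nat \<Rightarrow> real) \<Rightarrow> real \<Rightarrow> real \<Rightarrow> real \<Rightarrow> real \<Rightarrow>
   (nat \<Rightarrow> real) \<Rightarrow> (nat \<Rightarrow> real) \<Rightarrow> (nat \<Rightarrow> real) \<Rightarrow> (nat \<Rightarrow> real) \<Rightarrow>
   (nat \<Rightarrow> nat \<Rightarrow> real) \<Rightarrow> real \<Rightarrow> bool" where
  "feasible_B N lam s2 Pmax CI CEH p \<pi> ppi ptot x t \<longleftrightarrow>
     (let P = total_power N p; M = levels N; Nu = (2::nat) ^ M in
       (\<forall>k\<in>{1..M}. \<forall>i\<in>{1..2 ^ (M - k)}. x (k - 1) (2 * i - 1) * x (k - 1) (2 * i) \<ge> (x k i)\<^sup>2) \<and>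
       x M 1 \<ge> t \<and> t = 2 powr (CI / real Nu) * (1 + s2 * P) \<and>
       (\<forall>i\<in>{1..N}. x 0 i = 1 + s2 * P + ppi i * lam i) \<and>
       (\<forall>i\<in>{N+1..Nu}. x 0 i = 1 + s2 * P) \<and>
       (\<forall>k\<in>{0..M}. \<forall>i\<in>{1..2 ^ (M - k)}. x k i \<ge> 0) \<and>
       (\<Sum>i\<in>{1..N}. (p i - ppi i) * lam i) + s2 * (real N * P - (\<Sum>i\<in>{1..N}. ptot i)) \<ge> CEH \<and>
       (\<forall>i\<in>{1..N}. ppi i \<le> \<pi> i * Pmax \<and> ppi i \<le> p i \<and>
          ppi i \<ge> p i - (1 - \<pi> i) * Pmax \<and> ppi i \<ge> 0) \<and>
       (\<forall>i\<in>{1..N}. ptot i \<le> \<pi> i * real N * Pmax \<and> ptot i \<le> P \<and>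
          ptot i \<ge> P - (1 - \<pi> i) * real N * Pmax \<and> ptot i \<ge> 0) \<and>
       (\<forall>i\<in>{1..N}. 0 \<le> p i \<and> p i \<le> Pmax) \<and>
       (\<forall>i\<in>{1..N}. \<pi> i \<in> {0, 1}))"

definition objective_B ::
  "nat \<Rightarrow> (nat \<Rightarrow> real) \<Rightarrow> (nat \<Rightarrow> real) \<Rightarrow> (nat \<Rightarrow> real) \<Rightarrow> (nat \<Rightarrow> real) \<Rightarrow>
   (nat \<Rightarrow> nat \<Rightarrow> real) \<Rightarrow> real \<Rightarrow> real" where
  "objective_B N p \<pi> ppi ptot x t = total_power N p"

end

theory Submission
  imports Defs
begin

text \<open>
  For binary \<open>\<pi>\<close> the big-M constraints force \<open>ppi i = \<pi> i * p i\<close> and \<open>ptot i = \<pi> i * P\<close>, so the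
  two harvesting constraints coincide. The rate constraint says that the product of the first
  row \<open>x 0\<close>, padded with the neutral value \<open>1 + \<sigma>\<^sub>\<epsilon>\<^sup>2 P\<close> up to length \<open>N\<^sub>u\<close>, is at least \<open>t ^ N\<^sub>u\<close>,
  and the binary tree of cone constraints expresses exactly that \<open>t\<close> is at most the geometric
  mean of this row: it bounds \<open>x M 1\<close> by the geometric mean, with equality for the tree of
  square roots.
\<close>

text \<open>For nonnegative leaves, entry \<open>i\<close> of row \<open>k\<close> is the geometric
  mean of the block of \<open>2 ^ k\<close> leaves from \<open>(i - 1) * 2 ^ k + 1\<close> to
  \<open>i * 2 ^ k\<close>. Rows count from 1, which explains the children \<open>2 * i - 1\<close>
  and \<open>2 * i\<close>.\<close>

fun gm_tree :: "(nat \<Rightarrow> real) \<Rightarrow> nat \<Rightarrow> nat \<Rightarrow> real" where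
  "gm_tree f 0 i = f i"
| "gm_tree f (Suc k) i = sqrt (gm_tree f k (2 * i - 1) * gm_tree f k (2 * i))"

lemma pair_indices:
  fixes i k M :: nat
  assumes "k < M" "i \<in> {1..2 ^ (M - Suc k)}"
  shows "2 * i - 1 \<in> {1..2 ^ (M - k)}" "2 * i \<in> {1..2 ^ (M - k)}"
proof -
  have "M - k = Suc (M - Suc k)"
    using assms by simp
  then have "(2::nat) ^ (M - k) = 2 * 2 ^ (M - Suc k)"
    by simp
  with assms show "2 * i - 1 \<in> {1..2 ^ (M - k)}" "2 * i \<in> {1..2 ^ (M - k)}"
    by auto
qed

lemma gm_tree_nonneg:
  assumes "\<And>i. i \<in> {1..2 ^ M} \<Longrightarrow> f i \<ge> 0" "k \<le> M" "i \<in> {1..2 ^ (M - k)}"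
  shows "gm_tree f k i \<ge> 0"
  using assms(2,3)
proof (induction k arbitrary: i)
  case 0
  then show ?case using assms(1) by simp
next
  case (Suc k)
  then show ?case using pair_indices[of k M i] by (simp del: One_nat_def)
qed

lemma prod_pairs:
  fixes g :: "nat \<Rightarrow> 'a::comm_monoid_mult"
  shows "(\<Prod>i\<in>{1..2 * n}. g i) = (\<Prod>i\<in>{1..n}. g (2 * i - 1) * g (2 * i))"
  by (induction n) (simp_all add: mult.assoc)

text \<open>Multiplying the cone constraints along one row bounds the squared product of that row by
  the product of the row below. Raising this to the power \<open>2 ^ k\<close> extends the chain by
  one level; the smaller side is always a square, so monotonicity of powers applies.\<close>

lemma geometric_mean_tree_le:
  fixes x :: "nat \<Rightarrow> nat \<Rightarrow> real"
  assumes cone: "\<And>k i. k < M \<Longrightarrow> i \<in> {1..2 ^ (M - Suc k)} \<Longrightarrow>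
      (x (Suc k) i)\<^sup>2 \<le> x k (2 * i - 1) * x k (2 * i)"
    and "k \<le> M"
  shows "(\<Prod>i\<in>{1..2 ^ (M - k)}. x k i) ^ (2 ^ k) \<le> (\<Prod>i\<in>{1..2 ^ M}. x 0 i)"
  using \<open>k \<le> M\<close>
proof (induction k)
  case 0
  then show ?case by simp
next
  case (Suc k)
  then have k: "k < M" by simp
  have len: "(2::nat) ^ (M - k) = 2 * 2 ^ (M - Suc k)"
    using k by (metis Suc_diff_Suc power_Suc)
  have "(\<Prod>i\<in>{1..2 ^ (M - Suc k)}. x (Suc k) i)\<^sup>2
      = (\<Prod>i\<in>{1..2 ^ (M - Suc k)}. (x (Suc k) i)\<^sup>2)"
    by (simp add: prod_power_distrib)
  also have "\<dots> \<le> (\<Prod>i\<in>{1..2 ^ (M - Suc k)}. x k (2 * i - 1) * x k (2 * i))"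
    by (intro prod_mono) (use cone k in auto)
  also have "\<dots> = (\<Prod>i\<in>{1..2 ^ (M - k)}. x k i)"
    unfolding len by (rule prod_pairs[symmetric])
  finally have "((\<Prod>i\<in>{1..2 ^ (M - Suc k)}. x (Suc k) i)\<^sup>2) ^ (2 ^ k)
      \<le> (\<Prod>i\<in>{1..2 ^ (M - k)}. x k i) ^ (2 ^ k)"
    by (rule power_mono) simp
  then show ?case
    using Suc k by (simp add: power_mult)
qed

text \<open>The same telescoping with equalities. Nonnegative leaves ensure that squaring each root
  gives back the product of its two children rather than its absolute value.\<close>

lemma geometric_mean_gm_tree:
  assumes nonneg: "\<And>i. i \<in> {1..2 ^ M} \<Longrightarrow> f i \<ge> 0"
    and "k \<le> M"
  shows "(\<Prod>i\<in>{1..2 ^ (M - k)}. gm_tree f k i) ^ (2 ^ k) = (\<Prod>i\<in>{1..2 ^ M}. f i)"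
  using \<open>k \<le> M\<close>
proof (induction k)
  case 0
  then show ?case by simp
next
  case (Suc k)
  then have k: "k < M" by simp
  have len: "(2::nat) ^ (M - k) = 2 * 2 ^ (M - Suc k)"
    using k by (metis Suc_diff_Suc power_Suc)
  have "(\<Prod>i\<in>{1..2 ^ (M - Suc k)}. gm_tree f (Suc k) i)\<^sup>2
      = (\<Prod>i\<in>{1..2 ^ (M - Suc k)}. (gm_tree f (Suc k) i)\<^sup>2)"
    by (simp add: prod_power_distrib)
  also have "\<dots> = (\<Prod>i\<in>{1..2 ^ (M - Suc k)}. gm_tree f k (2 * i - 1) * gm_tree f k (2 * i))"
  proof (rule prod.cong[OF refl])
    fix i assume "i \<in> {1..(2::nat) ^ (M - Suc k)}"
    from pair_indices[OF k this]
    have "gm_tree f k (2 * i - 1) \<ge> 0" "gm_tree f k (2 * i) \<ge> 0"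
      using k nonneg by (auto intro!: gm_tree_nonneg[where M = M] simp del: atLeastAtMost_iff)
    then show "(gm_tree f (Suc k) i)\<^sup>2 = gm_tree f k (2 * i - 1) * gm_tree f k (2 * i)"
      by simp
  qed
  also have "\<dots> = (\<Prod>i\<in>{1..2 ^ (M - k)}. gm_tree f k i)"
    unfolding len by (rule prod_pairs[symmetric])
  finally have "((\<Prod>i\<in>{1..2 ^ (M - Suc k)}. gm_tree f (Suc k) i)\<^sup>2) ^ (2 ^ k)
      = (\<Prod>i\<in>{1..2 ^ (M - k)}. gm_tree f k i) ^ (2 ^ k)"
    by simp
  then show ?case
    using Suc k by (simp add: power_mult)
qed

text \<open>Exponentiate and multiply by \<open>c ^ n\<close>: each factor
  \<open>1 + a i / c\<close> takes one \<open>c\<close> and becomes \<open>y i\<close>, and the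
  remaining \<open>n - N\<close> copies of \<open>c\<close> are the padding. The \<open>n\<close>-th
  power undoes the division by \<open>n\<close> in the exponent of 2.\<close>

lemma sum_log_ge_iff_power_le_prod:
  fixes a y :: "nat \<Rightarrow> real"
  assumes "c > 0" "N \<le> n" "0 < n"
    and a: "\<And>i. i \<in> {1..N} \<Longrightarrow> a i \<ge> 0"
    and y: "\<And>i. i \<in> {1..N} \<Longrightarrow> y i = c + a i" "\<And>i. i \<in> {N+1..n} \<Longrightarrow> y i = c"
  shows "C \<le> (\<Sum>i\<in>{1..N}. log 2 (1 + a i / c)) \<longleftrightarrow>
    (2 powr (C / real n) * c) ^ n \<le> (\<Prod>i\<in>{1..n}. y i)"
proof -
  let ?q = "\<Prod>i\<in>{1..N}. 1 + a i / c"
  have pos: "1 + a i / c > 0" if "i \<in> {1..N}" for i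
    using a[OF that] \<open>c > 0\<close> by (simp add: add_pos_nonneg)
  have "?q > 0"
    by (intro prod_pos) (use pos in auto)
  have "(\<Sum>i\<in>{1..N}. log 2 (1 + a i / c)) = log 2 ?q"
    unfolding log_def sum_divide_distrib[symmetric]
    by (subst ln_prod) (use pos in fastforce)+
  moreover have "C \<le> log 2 ?q \<longleftrightarrow> 2 powr C \<le> ?q"
    using \<open>?q > 0\<close> by (simp add: le_log_iff)
  moreover have "(2 powr (C / real n) * c) ^ n = 2 powr C * c ^ n"
    using \<open>0 < n\<close> by (simp add: power_mult_distrib flip: powr_realpow) (simp add: powr_powr)
  moreover have "(\<Prod>i\<in>{1..n}. y i) = ?q * c ^ n"
  proof -
    have "{1..n} = {1..N} \<union> {N+1..n}"
      using \<open>N \<le> n\<close> by auto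
    then have "(\<Prod>i\<in>{1..n}. y i) = (\<Prod>i\<in>{1..N}. y i) * (\<Prod>i\<in>{N+1..n}. y i)"
      by (simp only:) (rule prod.union_disjoint, auto)
    also have "(\<Prod>i\<in>{N+1..n}. y i) = c ^ (n - N)"
      using y(2) by simp
    also have "(\<Prod>i\<in>{1..N}. y i) = (\<Prod>i\<in>{1..N}. (1 + a i / c) * c)"
      by (rule prod.cong) (use y(1) \<open>c > 0\<close> in \<open>auto simp: field_simps\<close>)
    also have "\<dots> = ?q * c ^ N"
      by (simp add: prod.distrib)
    also have "?q * c ^ N * c ^ (n - N) = ?q * c ^ n"
      using \<open>N \<le> n\<close> by (simp add: mult.assoc flip: power_add)
    finally show ?thesis .
  qed
  ultimately show ?thesis
    using \<open>c > 0\<close> by simp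
qed

text \<open>Rounding up and truncating at 0 can only increase the logarithm, so the tree has a leaf
  for every index in \<open>{1..N}\<close>.\<close>

lemma le_two_power_levels:
  assumes "N \<ge> 1"
  shows "N \<le> 2 ^ levels N"
proof -
  have "log 2 (real N) \<le> real (levels N)"
    unfolding levels_def by linarith
  then have "real N \<le> 2 powr real (levels N)"
    using assms by (simp add: log_le_iff)
  then have "real N \<le> real (2 ^ levels N)"
    by (simp add: powr_realpow)
  then show ?thesis
    by (simp only: of_nat_le_iff)
qed

theorem mainTheorem2:
  fixes N :: nat
    and lam :: "nat \<Rightarrow> real"
    and s2 Pmax CI CEH :: real
    and p \<pi> :: "nat \<Rightarrow> real"
  assumes "N \<ge> 1"
    and "\<forall>i\<in>{1..N}. \<forall>j\<in>{1..N}. i \<le> j \<longrightarrow> lam i \<ge> lam j"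
    and "lam N > 0"
    and "s2 \<ge> 0"
    and "0 < Pmax"
    and "CI > 0"
    and "CEH > 0"
  shows "(feasible_A N lam s2 Pmax CI CEH p \<pi> \<longleftrightarrow>
            (\<exists>ppi ptot x t. feasible_B N lam s2 Pmax CI CEH p \<pi> ppi ptot x t)) \<and>
         (\<forall>ppi ptot x t. feasible_B N lam s2 Pmax CI CEH p \<pi> ppi ptot x t \<longrightarrow>
            objective_B N p \<pi> ppi ptot x t = objective_A N p \<pi>)"
proof (intro conjI allI impI)
  define P where "P = total_power N p"
  define M where "M = levels N"
  define Nu where "Nu = (2::nat) ^ M"
  define c where "c = 1 + s2 * P"
  \<comment> \<open>The first row that (B) prescribes once \<open>ppi i = \<pi> i * p i\<close>; it
    also supplies the leaves of the witness tree.\<close>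
  define y where "y i = (if i \<le> N then c + \<pi> i * p i * lam i else c)" for i
  define t0 where "t0 = 2 powr (CI / real Nu) * c"
  have "N \<le> Nu"
    using le_two_power_levels[OF \<open>N \<ge> 1\<close>] by (simp add: Nu_def M_def)
  have "Nu > 0"
    by (simp add: Nu_def)
  have lam: "lam i \<ge> 0" if "i \<in> {1..N}" for i
    using assms(1,2,3) that by (force intro: order_trans[of 0 "lam N"])
  \<comment> \<open>The premises are the box and integrality constraints shared by (A) and (B), so
    these facts serve both directions.\<close>
  have binary: "(\<forall>i\<in>{1..N}. \<pi> i \<in> {0, 1}) \<and> (\<forall>i\<in>{1..N}. 0 \<le> p i \<and> p i \<le> Pmax) \<Longrightarrow>
     0 \<le> P \<and> P \<le> real N * Pmax \<and> 1 \<le> c \<and> (\<forall>i\<in>{1..N}. 0 \<le> \<pi> i * p i * lam i) \<and>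
     (CI \<le> (\<Sum>i\<in>{1..N}. log 2 (1 + \<pi> i * p i * lam i / c)) \<longleftrightarrow> t0 ^ Nu \<le> (\<Prod>i\<in>{1..Nu}. y i))"
    (is "?bounds \<Longrightarrow> _")
  proof -
    assume h: ?bounds
    have P0: "0 \<le> P"
      unfolding P_def total_power_def by (rule sum_nonneg) (use h in auto)
    have PN: "P \<le> real N * Pmax"
      unfolding P_def total_power_def using sum_bounded_above[of "{1..N}" p Pmax] h by auto
    have c1: "1 \<le> c"
      using P0 \<open>s2 \<ge> 0\<close> by (simp add: c_def)
    have a: "0 \<le> \<pi> i * p i * lam i" if "i \<in> {1..N}" for i
      using h lam[OF that] that by fastforce
    have "CI \<le> (\<Sum>i\<in>{1..N}. log 2 (1 + \<pi> i * p i * lam i / c)) \<longleftrightarrow> t0 ^ Nu \<le> (\<Prod>i\<in>{1..Nu}. y i)"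
      unfolding t0_def
      by (rule sum_log_ge_iff_power_le_prod) (use c1 a \<open>N \<le> Nu\<close> \<open>Nu > 0\<close> in \<open>auto simp: y_def\<close>)
    with P0 PN c1 a show ?thesis by blast
  qed
  \<comment> \<open>Pure algebra: the term \<open>real N * P\<close> supplies one \<open>P\<close>
    for each index.\<close>
  have harvest: "(\<Sum>i\<in>{1..N}. (p i - \<pi> i * p i) * lam i) + s2 * (real N * P - (\<Sum>i\<in>{1..N}. \<pi> i * P))
     = (\<Sum>i\<in>{1..N}. (1 - \<pi> i) * (p i * lam i + s2 * P))"
    by (simp add: algebra_simps sum.distrib sum_subtractf sum_distrib_left)
  show "feasible_A N lam s2 Pmax CI CEH p \<pi> \<longleftrightarrow>
    (\<exists>ppi ptot x t. feasible_B N lam s2 Pmax CI CEH p \<pi> ppi ptot x t)"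
  proof
    assume "feasible_A N lam s2 Pmax CI CEH p \<pi>"
    then have A: "CI \<le> (\<Sum>i\<in>{1..N}. log 2 (1 + \<pi> i * p i * lam i / c))"
        "CEH \<le> (\<Sum>i\<in>{1..N}. (1 - \<pi> i) * (p i * lam i + s2 * P))"
        "\<forall>i\<in>{1..N}. 0 \<le> p i \<and> p i \<le> Pmax" "\<forall>i\<in>{1..N}. \<pi> i \<in> {0, 1}"
      by (simp_all add: feasible_A_def Let_def P_def c_def)
    note b = binary[OF conjI, OF A(4,3)]
    let ?x = "gm_tree y"
    have y0: "y i \<ge> 0" if "i \<in> {1..2 ^ M}" for i
      using b that by (auto simp: y_def)
    have x0: "?x k i \<ge> 0" if "k \<le> M" "i \<in> {1..2 ^ (M - k)}" for k i
      using gm_tree_nonneg[OF y0 that] .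
    \<comment> \<open>At \<open>k = M\<close> the row consists of the root alone, and the exponent
      is \<open>2 ^ M = Nu\<close>.\<close>
    have "t0 ^ Nu \<le> (?x M 1) ^ Nu"
      using geometric_mean_gm_tree[of M y M] y0 A(1) b by (simp add: Nu_def)
    then have "t0 \<le> ?x M 1"
      using x0[of M 1] b \<open>Nu > 0\<close> by (simp add: power_mono_iff t0_def)
    moreover have "\<forall>k\<in>{1..M}. \<forall>i\<in>{1..2 ^ (M - k)}.
      (?x k i)\<^sup>2 \<le> ?x (k - 1) (2 * i - 1) * ?x (k - 1) (2 * i)"
    proof (intro ballI)
      fix k i assume ki: "k \<in> {1..M}" "i \<in> {1..(2::nat) ^ (M - k)}"
      then obtain k' where k': "k = Suc k'" "k' < M"
        by (cases k) auto
      with pair_indices[of k' M i] ki x0[of k'] show "(?x k i)\<^sup>2 \<le> ?x (k - 1) (2 * i - 1) * ?x (k - 1) (2 * i)"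
        by (simp del: One_nat_def)
    qed
    moreover have "\<forall>i\<in>{1..N}. \<pi> i * p i \<le> \<pi> i * Pmax \<and> \<pi> i * p i \<le> p i \<and>
        \<pi> i * p i \<ge> p i - (1 - \<pi> i) * Pmax \<and> \<pi> i * p i \<ge> 0"
      using A(3,4) by fastforce
    \<comment> \<open>The bound \<open>P \<le> real N * Pmax\<close> makes the big-M constant large
      enough in both cases of \<open>\<pi> i\<close>.\<close>
    moreover have "\<forall>i\<in>{1..N}. \<pi> i * P \<le> \<pi> i * real N * Pmax \<and> \<pi> i * P \<le> P \<and>
        \<pi> i * P \<ge> P - (1 - \<pi> i) * real N * Pmax \<and> \<pi> i * P \<ge> 0"
      using A(4) b by fastforce
    ultimately have "feasible_B N lam s2 Pmax CI CEH p \<pi> (\<lambda>i. \<pi> i * p i) (\<lambda>i. \<pi> i * P) ?x t0"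
      using A(2,3,4) x0 harvest
      unfolding feasible_B_def Let_def P_def[symmetric] M_def[symmetric] Nu_def[symmetric]
        c_def[symmetric]
      by (auto simp: t0_def y_def)
    then show "\<exists>ppi ptot x t. feasible_B N lam s2 Pmax CI CEH p \<pi> ppi ptot x t"
      by blast
  next
    assume "\<exists>ppi ptot x t. feasible_B N lam s2 Pmax CI CEH p \<pi> ppi ptot x t"
    then obtain ppi ptot x t where "feasible_B N lam s2 Pmax CI CEH p \<pi> ppi ptot x t"
      by blast
    note B = this[unfolded feasible_B_def Let_def P_def[symmetric] M_def[symmetric]
        Nu_def[symmetric] c_def[symmetric]]
    have bin: "\<forall>i\<in>{1..N}. \<pi> i \<in> {0, 1}" and bd: "\<forall>i\<in>{1..N}. 0 \<le> p i \<and> p i \<le> Pmax"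
      using B by blast+
    note b = binary[OF conjI, OF bin bd]
    \<comment> \<open>If \<open>\<pi> i = 0\<close>, the first and last bounds squeeze
      \<open>ppi i\<close> to 0; if \<open>\<pi> i = 1\<close>, the middle two squeeze it to
      \<open>p i\<close>. The argument for \<open>ptot\<close> is the same with \<open>P\<close> in
      place of \<open>p i\<close>.\<close>
    have ppi: "ppi i = \<pi> i * p i" if "i \<in> {1..N}" for i
    proof -
      have "ppi i \<le> \<pi> i * Pmax \<and> ppi i \<le> p i \<and> ppi i \<ge> p i - (1 - \<pi> i) * Pmax \<and> ppi i \<ge> 0"
        using B that by blast
      moreover have "\<pi> i = 0 \<or> \<pi> i = 1" using bin that by blast
      ultimately show ?thesis by auto
    qed
    have ptot: "ptot i = \<pi> i * P" if "i \<in> {1..N}" for i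
    proof -
      have "ptot i \<le> \<pi> i * real N * Pmax \<and> ptot i \<le> P \<and>
          ptot i \<ge> P - (1 - \<pi> i) * real N * Pmax \<and> ptot i \<ge> 0"
        using B that by blast
      moreover have "\<pi> i = 0 \<or> \<pi> i = 1" using bin that by blast
      ultimately show ?thesis by auto
    qed
    have cone: "(x (Suc k) i)\<^sup>2 \<le> x k (2 * i - 1) * x k (2 * i)"
      if "k < M" "i \<in> {1..2 ^ (M - Suc k)}" for k i
    proof -
      have "Suc k \<in> {1..M}" using that by simp
      then have "(x (Suc k) i)\<^sup>2 \<le> x (Suc k - 1) (2 * i - 1) * x (Suc k - 1) (2 * i)"
        using B that(2) by blast
      then show ?thesis by simp
    qed
    have t: "t = t0" "t \<le> x M 1"
      using B by (auto simp: t0_def)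
    \<comment> \<open>Taking powers preserves the order because \<open>c \<ge> 1\<close> makes
      \<open>t0\<close> nonnegative.\<close>
    have "t0 ^ Nu \<le> (x M 1) ^ Nu"
      using t b by (intro power_mono) (auto simp: t0_def)
    also have "\<dots> \<le> (\<Prod>i\<in>{1..Nu}. x 0 i)"
      using geometric_mean_tree_le[of M x M, OF cone] by (simp add: Nu_def)
    also have "\<dots> = (\<Prod>i\<in>{1..Nu}. y i)"
    proof (rule prod.cong[OF refl])
      fix i assume "i \<in> {1..Nu}"
      then show "x 0 i = y i"
        using B ppi by (cases "i \<le> N") (auto simp: y_def)
    qed
    finally have "CI \<le> (\<Sum>i\<in>{1..N}. log 2 (1 + \<pi> i * p i * lam i / c))"
      using b by blast
    moreover have "CEH \<le> (\<Sum>i\<in>{1..N}. (1 - \<pi> i) * (p i * lam i + s2 * P))"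
    proof -
      have "CEH \<le> (\<Sum>i\<in>{1..N}. (p i - ppi i) * lam i) + s2 * (real N * P - (\<Sum>i\<in>{1..N}. ptot i))"
        using B by blast
      also have "\<dots> = (\<Sum>i\<in>{1..N}. (p i - \<pi> i * p i) * lam i)
          + s2 * (real N * P - (\<Sum>i\<in>{1..N}. \<pi> i * P))"
        using ppi ptot by simp
      finally show ?thesis unfolding harvest .
    qed
    ultimately show "feasible_A N lam s2 Pmax CI CEH p \<pi>"
      using bin bd by (simp add: feasible_A_def Let_def P_def c_def)
  qed
qed (simp add: objective_A_def objective_B_def)

end
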